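(* (a) Let $\gamma\ge1$ and $g\ge 5\gamma$ be integers such that $d:=\frac{(2g-2)-3(2\gamma-2)}{6}$ is an integer, and let $S$ be a $(3,\gamma)$-hyperelliptic numerical semigroup of genus $g$ with standard basis $(6,e_1,\dots,e_5)$ modulo $6$ such that $e_{3-i}+e_{6-i}=6id+3(2\gamma+1)-2i$ for $i=1,2$, and such that either $e_4<e_1$ or $e_4>e_1\ge 4g-6\gamma+7-2\min\{e_2,e_5\}$. If $g\ge 6\gamma+7$, then $\operatorname{ewt}(S)\ge g$. (b) More generally, let $N\ge2$, $\gamma\ge1$ and $g$ be integers such that $d:=\frac{(2g-2)-N(2\gamma-2)}{N(N-1)}$ is a positive integer, and let $S$ be any feasible $(N,\gamma)$-hyperelliptic numerical semigroup of multiplicity $2N$ and genus $g$. If $g>\frac N2(4\gamma+3)+1$, then $\operatorname{ewt}(S)\ge g$.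
   Context: A numerical semigroup is a submonoid $S\subset\mathbb N=\{0,1,2,\dots\}$ with finite complement; its genus is the number of gaps (elements of $\mathbb N\setminus S$), and its multiplicity is its smallest nonzero element. The effective weight $\operatorname{ewt}(S)$ is the number of pairs $0<a<b$ of integers with $a$ a minimal generator of $S$ and $b\notin S$. If $2N\in S$, the standard basis of $S$ modulo $2N$ is $(2N,e_1,\dots,e_{2N-1})$, where $e_i$ is the smallest nonzero element of $S$ congruent to $i$ modulo $2N$. $S$ (containing $2N$) is $(N,\gamma)$-hyperelliptic if $\mathbb N\setminus S$ contains precisely $\gamma$ multiples of $N$, all strictly less than $2N\gamma$. The feasible set $F(N)$ is the set of $(a_1,\dots,a_{N-1})\in\mathbb Z^{N-1}$ with $jd\le a_j\le jd+\gamma$ for all $j$ and $a_{i+j}\le a_i+a_j$ whenever $1\le i,j$ and $i+j\le N-1$. An $(N,\gamma)$-hyperelliptic semigroup $S$ of multiplicity $2N$ and genus $g$ is feasible if it is indexed by an element $(a_1,\dots,a_{N-1})$ of $F(N)$, i.e. its standard basis modulo $2N$ satisfies $\min\{e_{N-j},e_{2N-j}\}=Na_j-j$ and $e_{N-j}+e_{2N-j}=2jNd+(2\gamma+1)N-2j$ for $j=1,\dots,N-1$. *)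

theory Defs
  imports Complex_Main "HOL-Library.FuncSet" "HOL-Number_Theory.Cong"
begin

definition numerical_semigroup :: "nat set \<Rightarrow> bool" where
  "numerical_semigroup S \<longleftrightarrow> 0 \<in> S \<and> (\<forall>x\<in>S. \<forall>y\<in>S. x + y \<in> S) \<and> finite (- S)"

definition genus :: "nat set \<Rightarrow> nat" where
  "genus S = card (- S)"

definition multiplicity_sg :: "nat set \<Rightarrow> nat" where
  "multiplicity_sg S = (LEAST x. x \<in> S \<and> x \<noteq> 0)"

definition minimal_generators :: "nat set \<Rightarrow> nat set" where
  "minimal_generators S =
     {a \<in> S. a \<noteq> 0 \<and> \<not> (\<exists>x\<in>S. \<exists>y\<in>S. x \<noteq> 0 \<and> y \<noteq> 0 \<and> a = x + y)}"

inductive_set submonoid_generated :: "nat set \<Rightarrow> nat set" for A where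
  zero: "0 \<in> submonoid_generated A"
| incl: "a \<in> A \<Longrightarrow> a \<in> submonoid_generated A"
| add: "x \<in> submonoid_generated A \<Longrightarrow> y \<in> submonoid_generated A \<Longrightarrow> x + y \<in> submonoid_generated A"

text \<open>The next two lemmas say that \<open>minimal_generators S\<close> is the least generating set of \<open>S\<close>.\<close>

lemma submonoid_generated_minimal_generators:
  assumes "numerical_semigroup S"
  shows "submonoid_generated (minimal_generators S) = S"
proof
  show "submonoid_generated (minimal_generators S) \<subseteq> S"
  proof
    fix x assume "x \<in> submonoid_generated (minimal_generators S)"
    then show "x \<in> S"
      by induction (use assms in \<open>auto simp: numerical_semigroup_def minimal_generators_def\<close>)
  qed
  have "x \<in> S \<Longrightarrow> x \<in> submonoid_generated (minimal_generators S)" for x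
  proof (induction x rule: less_induct)
    case (less x)
    consider "x = 0" | "x \<in> minimal_generators S"
      | u v where "u \<in> S" "v \<in> S" "u \<noteq> 0" "v \<noteq> 0" "x = u + v"
      using less.prems by (auto simp: minimal_generators_def)
    then show ?case
    proof cases
      case 3
      then show ?thesis
        using less.IH[of u] less.IH[of v] by (auto intro: submonoid_generated.add)
    qed (auto intro: submonoid_generated.intros)
  qed
  then show "S \<subseteq> submonoid_generated (minimal_generators S)" by blast
qed

lemma minimal_generators_subset_generating_set:
  assumes "submonoid_generated A = S"
  shows "minimal_generators S \<subseteq> A"
proof -
  have "x \<in> submonoid_generated A \<Longrightarrow> x \<in> minimal_generators S \<Longrightarrow> x \<in> A" for x
  proof (induction rule: submonoid_generated.induct)
    case (add x y)
    then show ?case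
      using assms by (cases "x = 0"; cases "y = 0") (auto simp: minimal_generators_def)
  qed (auto simp: minimal_generators_def)
  then show ?thesis
    using assms by (auto simp: minimal_generators_def)
qed

definition effective_weight :: "nat set \<Rightarrow> nat" where
  "effective_weight S =
     card {(a, b). 0 < a \<and> a < b \<and> a \<in> minimal_generators S \<and> b \<notin> S}"

text \<open>The standard basis of \<open>S\<close> modulo \<open>m\<close> (for \<open>m \<in> S\<close>) is
  \<open>(m, std_basis S m 1, \<dots>, std_basis S m (m - 1))\<close>.\<close>

definition std_basis :: "nat set \<Rightarrow> nat \<Rightarrow> nat \<Rightarrow> nat" where
  "std_basis S m i = (LEAST x. x \<in> S \<and> x \<noteq> 0 \<and> [x = i] (mod m))"

definition hyperelliptic_sg :: "nat \<Rightarrow> nat \<Rightarrow> nat set \<Rightarrow> bool" where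
  "hyperelliptic_sg N \<gamma> S \<longleftrightarrow>
     numerical_semigroup S \<and> 2 * N \<in> S \<and>
     card {m. N dvd m \<and> m \<notin> S} = \<gamma> \<and>
     (\<forall>m. N dvd m \<and> m \<notin> S \<longrightarrow> m < 2 * N * \<gamma>)"

text \<open>Tuples \<open>(a\<^sub>1, \<dots>, a\<^sub>N\<^sub>-\<^sub>1)\<close> of integers are extensional functions on \<open>{1..N-1}\<close>.\<close>

definition feasible_set :: "nat \<Rightarrow> nat \<Rightarrow> int \<Rightarrow> (nat \<Rightarrow> int) set" where
  "feasible_set N \<gamma> d =
     {a \<in> {1..N-1} \<rightarrow>\<^sub>E UNIV.
        (\<forall>j\<in>{1..N-1}. int j * d \<le> a j \<and> a j \<le> int j * d + int \<gamma>) \<and>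
        (\<forall>i j. 1 \<le> i \<and> 1 \<le> j \<and> i + j \<le> N - 1 \<longrightarrow> a (i + j) \<le> a i + a j)}"

text \<open>Below, \<open>d\<close> stands for the number determined by \<open>N\<close>, \<open>\<gamma>\<close> and the genus \<open>g\<close> via
  \<open>N (N - 1) d = (2 g - 2) - N (2 \<gamma> - 2)\<close>.\<close>

definition feasible_sg :: "nat \<Rightarrow> nat \<Rightarrow> int \<Rightarrow> nat set \<Rightarrow> bool" where
  "feasible_sg N \<gamma> d S \<longleftrightarrow>
     hyperelliptic_sg N \<gamma> S \<and> multiplicity_sg S = 2 * N \<and>
     (\<exists>a\<in>feasible_set N \<gamma> d. \<forall>j\<in>{1..N-1}.
        int (min (std_basis S (2*N) (N - j)) (std_basis S (2*N) (2*N - j))) = int N * a j - int j \<and>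
        int (std_basis S (2*N) (N - j)) + int (std_basis S (2*N) (2*N - j)) =
          2 * int j * int N * d + (2 * int \<gamma> + 1) * int N - 2 * int j)"

end

theory Submission
  imports Defs
begin

text \<open>
  Both parts are instances of \<open>effective_weight_ge_genus\<close>, which argues from the prescribed values
  of the sums \<open>e\<^sub>N\<^sub>-\<^sub>j + e\<^sub>2\<^sub>N\<^sub>-\<^sub>j\<close> of the standard basis; part (a) is the case \<open>N = 3\<close>. The effective
  weight is the sum over the minimal generators \<open>a\<close> of the number of gaps beyond \<open>a\<close>. Three
  generators have so many gaps beyond them that they already contribute \<open>g\<close>:
  \<^item> \<open>2N\<close> and \<open>(2\<gamma>+1)N\<close>, which together generate the multiples of \<open>N\<close> in \<open>S\<close>;
  \<^item> the least element \<open>x\<close> of \<open>S\<close> that is not a multiple of \<open>N\<close>.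

  The first two could fail to be minimal generators only by being a sum of two elements of \<open>S\<close>
  outside \<open>N\<int>\<close> (\<open>hyperelliptic_odd_multiple_ge\<close> excludes sums of multiples of \<open>N\<close>). Since
  \<open>(2\<gamma>+1)N\<close> lies in \<open>S\<close>, the two basis elements \<open>e\<^sub>N\<^sub>-\<^sub>j\<close> and \<open>e\<^sub>2\<^sub>N\<^sub>-\<^sub>j\<close> differ by at most \<open>(2\<gamma>+1)N\<close>; as
  their sum is known, every element of \<open>S\<close> congruent to \<open>-j\<close> modulo \<open>N\<close> is at least \<open>jNd - j\<close>
  (\<open>hyperelliptic_nonmultiple_ge\<close>), and such a sum is at least \<open>N(Nd - 1)\<close>, which exceeds
  \<open>(2\<gamma>+1)N\<close> in the given range of \<open>g\<close>. The smaller of \<open>e\<^sub>N\<^sub>-\<^sub>1\<close> and \<open>e\<^sub>2\<^sub>N\<^sub>-\<^sub>1\<close> is at most half of their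
  sum, which gives \<open>x < N(d+\<gamma>)\<close> (\<open>hyperelliptic_small_nonmultiple\<close>).

  Up to \<open>Nk\<close> there are at most \<open>\<gamma> + (N-1)k\<close> gaps: the \<open>\<gamma>\<close> multiples of \<open>N\<close>, and the \<open>(N-1)k\<close>
  positive integers that are not multiples of \<open>N\<close> (\<open>genus_le_gaps_above\<close>). Taking \<open>k = 2\<close>, \<open>2\<gamma>+1\<close>
  and \<open>d+\<gamma>\<close> for the three generators yields \<open>ewt(S) \<ge> 3g - 3\<gamma> - (N-1)(3\<gamma>+3+d)\<close>, and the right-hand
  side is at least \<open>g\<close>.
\<close>

section \<open>Effective weight and gaps\<close>

lemma effective_weight_ge_sum_gaps_above:
  assumes "numerical_semigroup S" and "finite A" and "A \<subseteq> minimal_generators S"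
  shows "(\<Sum>a\<in>A. card {b. a < b \<and> b \<notin> S}) \<le> effective_weight S"
proof -
  have fin: "finite (- S)"
    using assms(1) by (simp add: numerical_semigroup_def)
  have "(\<Sum>a\<in>A. card {b. a < b \<and> b \<notin> S}) = card (SIGMA a:A. {b. a < b \<and> b \<notin> S})"
    using assms(2) by (subst card_SigmaI) (auto intro: finite_subset[OF _ fin])
  also have "\<dots> \<le> effective_weight S"
    unfolding effective_weight_def
  proof (rule card_mono)
    have "finite (prod.swap ` (SIGMA b:- S. {..<b}))"
      using fin by auto
    then show "finite {(a, b). 0 < a \<and> a < b \<and> a \<in> minimal_generators S \<and> b \<notin> S}"
      by (rule rev_finite_subset) (auto simp: image_iff)
    show "(SIGMA a:A. {b. a < b \<and> b \<notin> S})
        \<subseteq> {(a, b). 0 < a \<and> a < b \<and> a \<in> minimal_generators S \<and> b \<notin> S}"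
      using assms(3) by (fastforce simp: minimal_generators_def)
  qed
  finally show ?thesis .
qed

lemma card_nonmultiples_le:
  fixes N k :: nat
  shows "card {b. b \<le> N * k \<and> \<not> N dvd b} \<le> (N - 1) * k"
proof (cases "N = 0")
  case False
  have "{b. b \<le> N * k \<and> \<not> N dvd b} \<subseteq> (\<lambda>(q, r). N * q + r) ` ({..<k} \<times> {1..<N})"
  proof
    fix b assume b: "b \<in> {b. b \<le> N * k \<and> \<not> N dvd b}"
    then have "b < N * k"
      by (cases "b = N * k") auto
    then have "b div N < k"
      using False by (simp add: less_mult_imp_div_less mult.commute)
    moreover have "b mod N \<in> {1..<N}"
      using b False by (auto simp: dvd_eq_mod_eq_0)
    ultimately show "b \<in> (\<lambda>(q, r). N * q + r) ` ({..<k} \<times> {1..<N})"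
      by (intro image_eqI[of _ _ "(b div N, b mod N)"]) auto
  qed
  then have "card {b. b \<le> N * k \<and> \<not> N dvd b} \<le> card ({..<k} \<times> {1..<N})"
    by (rule surj_card_le[rotated]) auto
  then show ?thesis
    by (simp add: mult.commute)
qed auto

lemma genus_le_gaps_above:
  assumes "hyperelliptic_sg N \<gamma> S" and "a \<le> N * k"
  shows "genus S \<le> \<gamma> + (N - 1) * k + card {b. a < b \<and> b \<notin> S}"
proof -
  let ?M = "{m. N dvd m \<and> m \<notin> S}" and ?L = "{b. b \<le> N * k \<and> \<not> N dvd b}"
    and ?G = "{b. a < b \<and> b \<notin> S}"
  have fin: "finite (- S)" and card: "card ?M = \<gamma>"
    using assms(1) by (auto simp: hyperelliptic_sg_def numerical_semigroup_def)
  have fins: "finite ?M" "finite ?G" "finite ?L"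
    by (auto intro: finite_subset[OF _ fin])
  have "genus S \<le> card (?M \<union> ?L \<union> ?G)"
    unfolding genus_def using assms(2) fins by (intro card_mono) auto
  also have "\<dots> \<le> card ?M + card ?L + card ?G"
    by (meson add_le_mono card_Un_le le_refl order_trans)
  finally show ?thesis
    using card_nonmultiples_le[of N k] card by linarith
qed

section \<open>Multiples of N\<close>

lemma hyperelliptic_even_multiple_mem:
  assumes "hyperelliptic_sg N \<gamma> S"
  shows "2 * N * k \<in> S"
  using assms by (induction k) (auto simp: hyperelliptic_sg_def numerical_semigroup_def)

lemma hyperelliptic_odd_multiple_mem:
  assumes "hyperelliptic_sg N \<gamma> S"
  shows "(2 * \<gamma> + 1) * N \<in> S"
proof (rule ccontr)
  assume "(2 * \<gamma> + 1) * N \<notin> S"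
  then have "(2 * \<gamma> + 1) * N < 2 * N * \<gamma>"
    using assms unfolding hyperelliptic_sg_def by (metis dvd_triv_right)
  then show False
    by (simp add: algebra_simps)
qed

text \<open>Adding multiples of \<open>2N\<close> to an odd multiple in \<open>S\<close> puts all later odd multiples of \<open>N\<close> into \<open>S\<close>,
  so \<open>\<gamma>\<close> gaps among the multiples of \<open>N\<close> require the first \<open>\<gamma>\<close> odd multiples to be gaps.\<close>

lemma hyperelliptic_odd_multiple_ge:
  assumes "hyperelliptic_sg N \<gamma> S" and "(2 * i + 1) * N \<in> S"
  shows "\<gamma> \<le> i"
proof -
  have S: "x + y \<in> S" if "x \<in> S" "y \<in> S" for x y
    using assms(1) that by (auto simp: hyperelliptic_sg_def numerical_semigroup_def)
  have "{m. N dvd m \<and> m \<notin> S} \<subseteq> (\<lambda>k. (2 * k + 1) * N) ` {..<i}"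
  proof
    fix m assume "m \<in> {m. N dvd m \<and> m \<notin> S}"
    then obtain q where q: "m = N * q" and m: "m \<notin> S"
      by auto
    have "odd q"
      using m q hyperelliptic_even_multiple_mem[OF assms(1)] by (auto elim!: evenE simp: mult.assoc mult.left_commute)
    then obtain k where k: "q = 2 * k + 1"
      by (rule oddE)
    have "k < i"
    proof (rule ccontr)
      assume "\<not> k < i"
      then have "m = (2 * i + 1) * N + 2 * N * (k - i)"
        using k q by (auto simp: algebra_simps dest!: le_Suc_ex[OF leI])
      then show False
        using m S[OF assms(2) hyperelliptic_even_multiple_mem[OF assms(1)]] by metis
    qed
    then show "m \<in> (\<lambda>k. (2 * k + 1) * N) ` {..<i}"
      using k q by auto
  qed
  then have "card {m. N dvd m \<and> m \<notin> S} \<le> card {..<i}"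
    by (rule surj_card_le[rotated]) simp
  then show ?thesis
    using assms(1) by (simp add: hyperelliptic_sg_def)
qed

section \<open>Elements that are not multiples of N\<close>

lemma std_basis_le:
  assumes "x \<in> S" and "x \<noteq> 0" and "[x = i] (mod m)"
  shows "std_basis S m i \<le> x"
  unfolding std_basis_def using assms by (intro Least_le) auto

lemma std_basis_props:
  assumes "numerical_semigroup S" and "0 < m"
  shows "std_basis S m i \<in> S" and "std_basis S m i \<noteq> 0" and "[std_basis S m i = i] (mod m)"
proof -
  obtain B where B: "\<forall>x\<in>- S. x < B"
    using assms(1) by (auto simp: numerical_semigroup_def finite_nat_set_iff_bounded)
  define x where "x = i + m * (B + 1)"
  have "B + 1 \<le> m * (B + 1)"
    using assms(2) mult_le_mono1[of 1 m "B + 1"] by simp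
  then have "B < x"
    unfolding x_def by linarith
  moreover have "[x = i] (mod m)"
    unfolding x_def cong_def by (rule mod_mult_self2)
  moreover have "x \<in> S"
    using B \<open>B < x\<close> by (metis ComplI less_asym)
  ultimately have "x \<in> S \<and> x \<noteq> 0 \<and> [x = i] (mod m)"
    by simp
  then have "std_basis S m i \<in> S \<and> std_basis S m i \<noteq> 0 \<and> [std_basis S m i = i] (mod m)"
    unfolding std_basis_def by (rule LeastI)
  then show "std_basis S m i \<in> S" "std_basis S m i \<noteq> 0" "[std_basis S m i = i] (mod m)"
    by auto
qed

definition prescribed_basis_sums :: "nat \<Rightarrow> nat \<Rightarrow> int \<Rightarrow> nat set \<Rightarrow> bool" where
  "prescribed_basis_sums N \<gamma> d S \<longleftrightarrow>
     (\<forall>j\<in>{1..N-1}. int (std_basis S (2*N) (N - j)) + int (std_basis S (2*N) (2*N - j)) =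
        2 * int j * int N * d + (2 * int \<gamma> + 1) * int N - 2 * int j)"

lemma std_basis_le_by_parity:
  assumes "x \<in> S" and "0 < j" and "j < N" and "x + j = N * q"
  shows "std_basis S (2*N) (if even q then 2*N - j else N - j) \<le> x"
proof (rule std_basis_le)
  show "x \<noteq> 0"
  proof
    assume "x = 0"
    then have "N dvd j"
      using assms(4) by simp
    then show False
      using assms(2,3) nat_dvd_not_less by blast
  qed
  show "[x = (if even q then 2*N - j else N - j)] (mod (2*N))"
  proof (cases "even q")
    case True
    then obtain k where "q = 2 * k"
      by blast
    then have "[x + j = (2*N - j) + j] (mod (2*N))"
      using assms(3,4) by (simp add: cong_def)
    then show ?thesis
      using True by (simp add: cong_add_rcancel_nat)
  next
    case False
    then obtain k where "q = 2 * k + 1"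
      by (rule oddE)
    then have "x + j = N + 2 * N * k"
      using assms(4) by (simp add: algebra_simps)
    then have "[x + j = (N - j) + j] (mod (2*N))"
      using assms(3) by (simp add: cong_def)
    then show ?thesis
      using False by (simp add: cong_add_rcancel_nat)
  qed
qed (fact assms(1))

text \<open>Both \<open>x\<close> and \<open>x + (2\<gamma>+1)N\<close> lie in \<open>S\<close>, and modulo \<open>2N\<close> they are congruent to \<open>N - j\<close> and
  \<open>2N - j\<close> in some order. So \<open>e\<^sub>N\<^sub>-\<^sub>j + e\<^sub>2\<^sub>N\<^sub>-\<^sub>j\<close> is at most their sum \<open>2x + (2\<gamma>+1)N\<close>.\<close>

lemma hyperelliptic_nonmultiple_ge:
  assumes hyp: "hyperelliptic_sg N \<gamma> S" and sums: "prescribed_basis_sums N \<gamma> d S"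
    and x: "x \<in> S" and j: "0 < j" "j < N" and dvd: "N dvd x + j"
  shows "int j * int N * d - int j \<le> int x"
proof -
  let ?y = "x + (2 * \<gamma> + 1) * N"
  have y: "?y \<in> S"
    using hyp x hyperelliptic_odd_multiple_mem[OF hyp]
    by (auto simp: hyperelliptic_sg_def numerical_semigroup_def)
  obtain q where q: "x + j = N * q"
    using dvd by blast
  then have q': "?y + j = N * (q + 2 * \<gamma> + 1)"
    by (simp add: algebra_simps)
  have "std_basis S (2*N) (N - j) + std_basis S (2*N) (2*N - j) \<le> x + ?y"
    using std_basis_le_by_parity[OF x j q] std_basis_le_by_parity[OF y j q']
    by (cases "even q") simp_all
  then have "int (std_basis S (2*N) (N - j)) + int (std_basis S (2*N) (2*N - j)) \<le> int x + int ?y"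
    by linarith
  moreover have "int (std_basis S (2*N) (N - j)) + int (std_basis S (2*N) (2*N - j)) =
      2 * (int j * int N * d) + int ((2 * \<gamma> + 1) * N) - 2 * int j"
    using sums j by (simp add: prescribed_basis_sums_def algebra_simps)
  ultimately show ?thesis
    by linarith
qed

text \<open>If \<open>u\<close> is congruent to \<open>i\<close> modulo \<open>N\<close>, with \<open>0 < i < N\<close>, then the bounds for \<open>j = N - i\<close> and
  \<open>j = i\<close> apply to \<open>u\<close> and \<open>v\<close>, and they add up to one that does not depend on \<open>i\<close>.\<close>

lemma hyperelliptic_nonmultiple_sum_ge:
  assumes hyp: "hyperelliptic_sg N \<gamma> S" and sums: "prescribed_basis_sums N \<gamma> d S"
    and uv: "u \<in> S" "v \<in> S" "\<not> N dvd u" "N dvd u + v" and N: "0 < N"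
  shows "int N * (int N * d - 1) \<le> int (u + v)"
proof -
  define i where "i = u mod N"
  have i: "0 < i" "i < N"
    using uv N by (auto simp: i_def dvd_eq_mod_eq_0)
  have "N dvd u + (N - i)"
  proof -
    have "u + (N - i) = N * (u div N) + N"
      using i mult_div_mod_eq[of N u] unfolding i_def by linarith
    then show ?thesis
      by simp
  qed
  then have u: "int (N - i) * int N * d - int (N - i) \<le> int u"
    using hyperelliptic_nonmultiple_ge[OF hyp sums uv(1), of "N - i"] i by simp
  have "N dvd v + i"
    using uv(4) by (simp add: i_def dvd_eq_mod_eq_0 mod_add_right_eq add.commute)
  then have v: "int i * int N * d - int i \<le> int v"
    using hyperelliptic_nonmultiple_ge[OF hyp sums uv(2), of i] i by simp
  show ?thesis
    using u v i by (simp add: of_nat_diff algebra_simps)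
qed

text \<open>The smaller of \<open>e\<^sub>N\<^sub>-\<^sub>1\<close> and \<open>e\<^sub>2\<^sub>N\<^sub>-\<^sub>1\<close> has the form \<open>Nq - 1\<close> and is at most half of the prescribed
  sum, that is \<open>N(d + \<gamma>) + N/2 - 1\<close>; hence \<open>q \<le> d + \<gamma>\<close>.\<close>

lemma hyperelliptic_small_nonmultiple:
  assumes hyp: "hyperelliptic_sg N \<gamma> S" and sums: "prescribed_basis_sums N \<gamma> d S" and N: "2 \<le> N"
  shows "\<exists>x\<in>S. \<not> N dvd x \<and> int x < int N * (d + int \<gamma>)"
proof -
  have S: "numerical_semigroup S" and pos: "0 < 2 * N"
    using hyp N by (auto simp: hyperelliptic_sg_def)
  let ?e1 = "std_basis S (2*N) (N - 1)" and ?e2 = "std_basis S (2*N) (2*N - 1)"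
  define x where "x = min ?e1 ?e2"
  have xS: "x \<in> S"
    using std_basis_props(1)[OF S pos] by (simp add: x_def min_def)
  have "[?e1 = N - 1] (mod N)"
    using std_basis_props(3)[OF S pos] by (rule cong_dvd_modulus_nat) simp
  moreover have "[?e2 = N - 1] (mod N)"
  proof -
    have "[?e2 = 2*N - 1] (mod N)"
      using std_basis_props(3)[OF S pos] by (rule cong_dvd_modulus_nat) simp
    moreover have "2*N - 1 = (N - 1) + N"
      using N by simp
    ultimately show ?thesis
      by (simp add: cong_def)
  qed
  ultimately have "[x = N - 1] (mod N)"
    by (simp add: x_def min_def)
  then have xmod: "x mod N = N - 1"
    using N by (simp add: cong_def)
  define q where "q = x div N + 1"
  have xq: "x + 1 = N * q"
    using mult_div_mod_eq[of N x] xmod N by (simp add: q_def)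
  have "2 * int x \<le> int ?e1 + int ?e2"
    by (simp add: x_def)
  also have "\<dots> = 2 * int N * d + (2 * int \<gamma> + 1) * int N - 2"
    using sums N by (simp add: prescribed_basis_sums_def)
  finally have "2 * int (x + 1) \<le> int N * (2 * (d + int \<gamma>) + 1)"
    by (simp add: algebra_simps)
  then have "int N * (2 * int q) \<le> int N * (2 * (d + int \<gamma>) + 1)"
    unfolding xq by (simp add: algebra_simps)
  then have "int q \<le> d + int \<gamma>"
    using N by (simp add: mult_le_cancel_left)
  then have "int (x + 1) \<le> int N * (d + int \<gamma>)"
    unfolding xq by (simp add: mult_left_mono)
  moreover have "\<not> N dvd x"
    using xmod N by (simp add: dvd_eq_mod_eq_0)
  ultimately show ?thesis
    using xS by (intro bexI[of _ x]) auto
qed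

section \<open>Three minimal generators\<close>

lemma even_multiple_minimal_generator:
  assumes hyp: "hyperelliptic_sg N \<gamma> S" and "1 \<le> \<gamma>" and N: "2 \<le> N"
    and sep: "\<And>u v. \<lbrakk>u \<in> S; v \<in> S; \<not> N dvd u; N dvd u + v\<rbrakk> \<Longrightarrow> 2 * N < u + v"
  shows "2 * N \<in> minimal_generators S"
proof -
  have False if uv: "u \<in> S" "v \<in> S" "u \<noteq> 0" "v \<noteq> 0" "2 * N = u + v" for u v
  proof (cases "N dvd u")
    case True
    moreover have "u < 2 * N"
      using uv by simp
    ultimately have "u = N"
      using uv(3) by (auto elim!: dvdE)
    then show False
      using hyperelliptic_odd_multiple_ge[OF hyp, of 0] uv(1) assms(2) by simp
  next
    case False
    then show False
      using sep[OF uv(1,2)] uv(5) by (metis dvd_triv_right less_irrefl)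
  qed
  then show ?thesis
    using hyp N unfolding minimal_generators_def hyperelliptic_sg_def by auto
qed

lemma odd_multiple_minimal_generator:
  assumes hyp: "hyperelliptic_sg N \<gamma> S" and N: "2 \<le> N"
    and sep: "\<And>u v. \<lbrakk>u \<in> S; v \<in> S; \<not> N dvd u; N dvd u + v\<rbrakk> \<Longrightarrow> (2 * \<gamma> + 1) * N < u + v"
  shows "(2 * \<gamma> + 1) * N \<in> minimal_generators S"
proof -
  (* One of two multiples of N with an odd multiple as sum is odd, and it is too small to lie in S. *)
  have odd_part: False if "N * k \<in> S" "odd k" "k < 2 * \<gamma> + 1" for k
  proof -
    obtain i where "k = 2 * i + 1"
      using \<open>odd k\<close> by (rule oddE)
    then show False
      using that hyperelliptic_odd_multiple_ge[OF hyp, of i] by (simp add: mult.commute)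
  qed
  have False if uv: "u \<in> S" "v \<in> S" "u \<noteq> 0" "v \<noteq> 0" "(2 * \<gamma> + 1) * N = u + v" for u v
  proof (cases "N dvd u")
    case True
    then have "N dvd v"
      using uv(5) by (metis dvd_add_right_iff dvd_triv_right)
    then obtain k l where kl: "u = N * k" "v = N * l"
      using True by (auto elim!: dvdE)
    then have "N * (2 * \<gamma> + 1) = N * (k + l)"
      using uv(5) by (simp add: algebra_simps)
    then have sum: "2 * \<gamma> + 1 = k + l"
      using N by (simp only: mult_cancel1) simp
    have "k \<noteq> 0" "l \<noteq> 0"
      using kl uv by auto
    moreover have "odd k \<or> odd l"
      using sum by presburger
    ultimately show False
      using odd_part[of k] odd_part[of l] sum uv(1,2) kl by fastforce
  next
    case False
    then show False
      using sep[OF uv(1,2)] uv(5) by (metis dvd_triv_right less_irrefl)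
  qed
  then show ?thesis
    using hyperelliptic_odd_multiple_mem[OF hyp] N unfolding minimal_generators_def by auto
qed

text \<open>If \<open>x\<close> were a sum of two nonzero elements of \<open>S\<close>, one of them would be a smaller non-multiple.\<close>

lemma least_nonmultiple_minimal_generator:
  assumes "x \<in> S" and "\<not> N dvd x" and least: "\<And>y. y \<in> S \<Longrightarrow> \<not> N dvd y \<Longrightarrow> x \<le> y"
  shows "x \<in> minimal_generators S"
proof -
  have False if uv: "u \<in> S" "v \<in> S" "u \<noteq> 0" "v \<noteq> 0" "x = u + v" for u v
  proof -
    have "\<not> N dvd u \<or> \<not> N dvd v"
      using assms(2) uv(5) by auto
    then show False
      using least[of u] least[of v] uv by auto
  qed
  moreover have "x \<noteq> 0"
    using assms(2) by (metis dvd_0_right)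
  ultimately show ?thesis
    using assms(1) unfolding minimal_generators_def by auto
qed

section \<open>The bound on the effective weight\<close>

theorem effective_weight_ge_genus:
  assumes hyp: "hyperelliptic_sg N \<gamma> S" and N: "2 \<le> N" and \<gamma>: "1 \<le> \<gamma>"
    and sums: "prescribed_basis_sums N \<gamma> d S"
    and d: "int N * (int N - 1) * d = 2 * int (genus S) - 2 - int N * (2 * int \<gamma> - 2)"
    and large: "int N * (4 * int \<gamma> + 3) + 2 < 2 * int (genus S)"
  shows "genus S \<le> effective_weight S"
proof -
  have S: "numerical_semigroup S"
    using hyp by (simp add: hyperelliptic_sg_def)
  have "int N * (2 * int \<gamma> + 5) < int N * ((int N - 1) * d)"
    using d large by (simp add: algebra_simps)
  then have dN: "2 * int \<gamma> + 6 \<le> (int N - 1) * d"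
    using N by (simp add: mult_less_cancel_left)
  have d_pos: "0 < d"
  proof -
    have "0 < (int N - 1) * d"
      using dN by linarith
    then show ?thesis
      using N by (simp add: zero_less_mult_iff)
  qed
  have sep: "(2 * \<gamma> + 1) * N < u + v"
    if "u \<in> S" "v \<in> S" "\<not> N dvd u" "N dvd u + v" for u v
  proof -
    have "2 * int \<gamma> + 1 < int N * d - 1"
      using dN d_pos by (simp add: algebra_simps)
    then have "int N * (2 * int \<gamma> + 1) < int N * (int N * d - 1)"
      using N by (simp add: mult_strict_left_mono)
    also have "\<dots> \<le> int (u + v)"
      using hyperelliptic_nonmultiple_sum_ge[OF hyp sums that] N by simp
    finally have "int ((2 * \<gamma> + 1) * N) < int (u + v)"
      by (simp add: algebra_simps)
    then show ?thesis
      by linarith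
  qed
  define x where "x = (LEAST x. x \<in> S \<and> \<not> N dvd x)"
  obtain z where z: "z \<in> S" "\<not> N dvd z" "int z < int N * (d + int \<gamma>)"
    using hyperelliptic_small_nonmultiple[OF hyp sums N] by auto
  have x: "x \<in> S" "\<not> N dvd x"
    using LeastI[of "\<lambda>x. x \<in> S \<and> \<not> N dvd x" z] z by (auto simp: x_def)
  have x_least: "x \<le> y" if "y \<in> S" "\<not> N dvd y" for y
    unfolding x_def using that by (intro Least_le) auto
  define k where "k = nat (d + int \<gamma>)"
  have k: "int k = d + int \<gamma>"
    using d_pos by (simp add: k_def)
  have "int x < int N * int k"
    using z x_least[OF z(1,2)] k by simp
  then have xk: "x \<le> N * k"
    by (metis of_nat_mult of_nat_less_iff less_imp_le)
  let ?A = "{2 * N, (2 * \<gamma> + 1) * N, x}"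
  let ?G = "\<lambda>a. card {b. a < b \<and> b \<notin> S}"
  have "?A \<subseteq> minimal_generators S"
  proof -
    have "2 * N < u + v" if "u \<in> S" "v \<in> S" "\<not> N dvd u" "N dvd u + v" for u v
    proof -
      have "2 * N \<le> (2 * \<gamma> + 1) * N"
        using \<gamma> by (intro mult_right_mono) auto
      then show ?thesis
        using sep[OF that] by linarith
    qed
    then show ?thesis
      using even_multiple_minimal_generator[OF hyp \<gamma> N] odd_multiple_minimal_generator[OF hyp N sep]
        least_nonmultiple_minimal_generator[OF x x_least] by simp
  qed
  then have "sum ?G ?A \<le> effective_weight S"
    by (intro effective_weight_ge_sum_gaps_above[OF S]) auto
  moreover have "sum ?G ?A = ?G (2 * N) + ?G ((2 * \<gamma> + 1) * N) + ?G x"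
  proof -
    have "2 * N \<noteq> (2 * \<gamma> + 1) * N"
      using N by (simp only: mult_cancel2) presburger
    moreover have "x \<noteq> 2 * N" "x \<noteq> (2 * \<gamma> + 1) * N"
      using x(2) by auto
    ultimately show ?thesis
      by simp
  qed
  ultimately have "int (?G (2 * N)) + int (?G ((2 * \<gamma> + 1) * N)) + int (?G x)
      \<le> int (effective_weight S)"
    by linarith
  moreover have gaps: "int (genus S) \<le> int \<gamma> + (int N - 1) * int k' + int (?G a)"
    if "a \<le> N * k'" for a k'
  proof -
    have "int (genus S) \<le> int (\<gamma> + (N - 1) * k' + ?G a)"
      using genus_le_gaps_above[OF hyp that] by linarith
    then show ?thesis
      using N by (simp add: of_nat_diff)
  qed
  have "int (genus S) \<le> int \<gamma> + (int N - 1) * 2 + int (?G (2 * N))"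
    using gaps[of "2 * N" 2] by simp
  moreover have "int (genus S) \<le> int \<gamma> + (int N - 1) * (2 * int \<gamma> + 1) + int (?G ((2 * \<gamma> + 1) * N))"
    using gaps[of "(2 * \<gamma> + 1) * N" "2 * \<gamma> + 1"] by (simp add: algebra_simps)
  moreover have "int (genus S) \<le> int \<gamma> + (int N - 1) * (d + int \<gamma>) + int (?G x)"
    using gaps[OF xk] k by simp
  ultimately have "3 * int (genus S) - 3 * int \<gamma> - (int N - 1) * (3 * int \<gamma> + 3 + d)
      \<le> int (effective_weight S)"
    by (simp add: algebra_simps)
  (* In terms of d, the bound 2 g >= 3 \<gamma> + (N - 1) (3 \<gamma> + 3 + d) reads
     (N - 1)^2 d >= N \<gamma> + 5 N - 5. *)
  moreover have "int N * int \<gamma> + 5 * int N - 5 \<le> (int N - 1) * ((int N - 1) * d)"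
  proof -
    have "(int N - 1) * (2 * int \<gamma> + 6) \<le> (int N - 1) * ((int N - 1) * d)"
      using dN N by (intro mult_left_mono) auto
    moreover have "0 \<le> (int N - 2) * int \<gamma>"
      using N by simp
    ultimately show ?thesis
      using N by (simp add: algebra_simps)
  qed
  ultimately have "int (genus S) \<le> int (effective_weight S)"
    using d by (simp add: algebra_simps)
  then show ?thesis
    by simp
qed

theorem theorem1p3:
  shows
    "(\<forall>(\<gamma>::nat) (g::nat) (d::int) (S::nat set) (e::nat \<Rightarrow> nat).
        \<gamma> \<ge> 1 \<and> g \<ge> 5 * \<gamma> \<and>
        real_of_int d = ((2 * real g - 2) - 3 * (2 * real \<gamma> - 2)) / 6 \<and>
        hyperelliptic_sg 3 \<gamma> S \<and> genus S = g \<and>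
        (\<forall>i. e i = std_basis S 6 i) \<and>
        (\<forall>i\<in>{1, 2}. int (e (3 - i)) + int (e (6 - i)) =
           6 * int i * d + 3 * (2 * int \<gamma> + 1) - 2 * int i) \<and>
        (e 4 < e 1 \<or>
         (e 4 > e 1 \<and> int (e 1) \<ge> 4 * int g - 6 * int \<gamma> + 7 - 2 * int (min (e 2) (e 5)))) \<and>
        g \<ge> 6 * \<gamma> + 7
        \<longrightarrow> effective_weight S \<ge> g)
     \<and>
     (\<forall>(N::nat) (\<gamma>::nat) (g::nat) (d::int) (S::nat set).
        N \<ge> 2 \<and> \<gamma> \<ge> 1 \<and>
        real_of_int d = ((2 * real g - 2) - real N * (2 * real \<gamma> - 2)) / (real N * (real N - 1)) \<and>
        d > 0 \<and>
        feasible_sg N \<gamma> d S \<and> genus S = g \<and>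
        real g > real N / 2 * (4 * real \<gamma> + 3) + 1
        \<longrightarrow> effective_weight S \<ge> g)"
proof (intro conjI allI impI; elim conjE)
  fix \<gamma> g :: nat and d :: int and S :: "nat set" and e :: "nat \<Rightarrow> nat"
  assume \<gamma>: "1 \<le> \<gamma>" and d: "real_of_int d = ((2 * real g - 2) - 3 * (2 * real \<gamma> - 2)) / 6"
    and hyp: "hyperelliptic_sg 3 \<gamma> S" and g: "genus S = g" and e: "\<forall>i. e i = std_basis S 6 i"
    and sums: "\<forall>i\<in>{1, 2}. int (e (3 - i)) + int (e (6 - i)) =
           6 * int i * d + 3 * (2 * int \<gamma> + 1) - 2 * int i"
    and large: "6 * \<gamma> + 7 \<le> g"
  have "prescribed_basis_sums 3 \<gamma> d S"
  proof -
    have "j = 1 \<or> j = 2" if "j \<in> {1..3 - 1}" for j :: nat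
      using that by auto
    then show ?thesis
      using sums e unfolding prescribed_basis_sums_def by fastforce
  qed
  moreover have "6 * d = 2 * int g - 2 - 3 * (2 * int \<gamma> - 2)"
    using d by (simp add: field_simps)
  ultimately show "g \<le> effective_weight S"
    using effective_weight_ge_genus[OF hyp _ \<gamma>] large g by simp
next
  fix N \<gamma> g :: nat and d :: int and S :: "nat set"
  assume N: "2 \<le> N" and \<gamma>: "1 \<le> \<gamma>"
    and d: "real_of_int d
      = ((2 * real g - 2) - real N * (2 * real \<gamma> - 2)) / (real N * (real N - 1))"
    and feas: "feasible_sg N \<gamma> d S" and g: "genus S = g"
    and large: "real N / 2 * (4 * real \<gamma> + 3) + 1 < real g"
  have hyp: "hyperelliptic_sg N \<gamma> S" and sums: "prescribed_basis_sums N \<gamma> d S"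
    using feas by (auto simp: feasible_sg_def prescribed_basis_sums_def)
  have "real N * (real N - 1) \<noteq> 0"
    using N by simp
  then have "real_of_int (int N * (int N - 1) * d)
      = real_of_int (2 * int g - 2 - int N * (2 * int \<gamma> - 2))"
    using d by (simp add: nonzero_eq_divide_eq mult.commute)
  then have d': "int N * (int N - 1) * d = 2 * int (genus S) - 2 - int N * (2 * int \<gamma> - 2)"
    unfolding g by (simp only: of_int_eq_iff)
  have "real_of_int (int N * (4 * int \<gamma> + 3) + 2) < real_of_int (2 * int g)"
    using large by simp
  then have "int N * (4 * int \<gamma> + 3) + 2 < 2 * int (genus S)"
    unfolding g by (simp only: of_int_less_iff)
  then show "g \<le> effective_weight S"
    using effective_weight_ge_genus[OF hyp N \<gamma> sums d'] g by simp
qed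

end
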